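(* Let $X$ and $Y$ be uniformly locally finite metric spaces, and let $\Phi\colon\mathrm{C}^*_u(X)\to\mathrm{C}^*_u(Y)$ be a strongly continuous linear map. If $Y$ has property A, then $\Phi$ is coarse-like.
   Context: A metric space $(X,d)$ is uniformly locally finite if $\sup_{x\in X}|B_r(x)|<\infty$ for all $r>0$. For $a\in\mathcal{B}(\ell_2(X))$ write $\mathrm{prop}(a)\leq r$ (propagation at most $r$) if $\langle a\delta_x,\delta_y\rangle=0$ whenever $d(x,y)>r$, where $(\delta_x)_{x\in X}$ is the canonical basis; $a$ has finite propagation if $\mathrm{prop}(a)\leq r$ for some $r>0$. The uniform Roe algebra $\mathrm{C}^*_u(X)$ is the norm closure in $\mathcal{B}(\ell_2(X))$ of the finite propagation operators. For $\varepsilon>0$ and $k\in\mathbb{N}$, an operator $a\in\mathcal{B}(\ell_2(X))$ can be $\varepsilon$-$k$-approximated if there is $b\in\mathcal{B}(\ell_2(X))$ with propagation at most $k$ and $\|a-b\|\leq\varepsilon$. A map $\Phi\colon\mathrm{C}^*_u(X)\to\mathrm{C}^*_u(Y)$ is coarse-like if for all $m\in\mathbb{N}$ and $\varepsilon>0$ there is $k\in\mathbb{N}$ such that $\Phi(a)$ can be $\varepsilon$-$k$-approximated for every contraction $a\in\mathrm{C}^*_u(X)$ with $\mathrm{prop}(a)\leq m$. $\Phi$ is strongly continuous if whenever a sequence $(a_k)_k$ in $\mathrm{C}^*_u(X)$ converges to $a\in\mathrm{C}^*_u(X)$ in the strong operator topology, $(\Phi(a_k))_k$ converges to $\Phi(a)$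 in the strong operator topology. Property A (Yu): $(Y,\partial)$ has property A if for all $r,\varepsilon>0$ there are $R>0$ and finite sets $A_x\subseteq Y\times\mathbb{N}$ ($x\in Y$) such that $(x,1)\in A_x$ for all $x$; $|A_x\triangle A_y|/|A_x\cap A_y|<\varepsilon$ whenever $\partial(x,y)\leq r$; and $\partial(y,z)\leq R$ whenever $(y,m),(z,n)\in A_x$ for some $x$. *)

theory Defs
  imports "HOL-Analysis.Analysis"
begin

section \<open>The complex Hilbert space of square-summable families\<close>

typedef 'a ell2 = "{f :: 'a \<Rightarrow> complex. (\<lambda>x. (cmod (f x))\<^sup>2) summable_on UNIV}"
  morphisms ell2_apply Abs_ell2
  by (rule exI[of _ "\<lambda>_. 0"]) simp

setup_lifting type_definition_ell2

lemma ell2_mult_bound: "a * b \<le> a\<^sup>2 + b\<^sup>2" for a b :: real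
proof -
  have "2 * (a * b) \<le> a\<^sup>2 + b\<^sup>2"
    using sum_squares_bound[of a b] by (simp add: mult.assoc)
  moreover have "0 \<le> a\<^sup>2 + b\<^sup>2" by simp
  ultimately show ?thesis by linarith
qed

lemma ell2_summable_mult:
  fixes f g :: "'a \<Rightarrow> complex"
  assumes "(\<lambda>x. (cmod (f x))\<^sup>2) summable_on UNIV" "(\<lambda>x. (cmod (g x))\<^sup>2) summable_on UNIV"
  shows "(\<lambda>x. f x * cnj (g x)) summable_on UNIV"
proof (rule abs_summable_summable)
  show "(\<lambda>x. norm (f x * cnj (g x))) summable_on UNIV"
    by (rule summable_on_comparison_test[OF summable_on_add[OF assms]])
       (auto simp: norm_mult ell2_mult_bound)
qed

lemma ell2_summable_scale:
  fixes f :: "'a \<Rightarrow> complex"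
  assumes "(\<lambda>x. (cmod (f x))\<^sup>2) summable_on UNIV"
  shows "(\<lambda>x. (cmod (c * f x))\<^sup>2) summable_on UNIV"
  using summable_on_cmult_right[OF assms, of "(cmod c)\<^sup>2"]
  by (simp add: norm_mult power_mult_distrib)

lemma ell2_summable_add:
  fixes f g :: "'a \<Rightarrow> complex"
  assumes f: "(\<lambda>x. (cmod (f x))\<^sup>2) summable_on UNIV"
    and g: "(\<lambda>x. (cmod (g x))\<^sup>2) summable_on UNIV"
  shows "(\<lambda>x. (cmod (f x + g x))\<^sup>2) summable_on UNIV"
proof (rule summable_on_comparison_test)
  show "(\<lambda>x. 2 * (cmod (f x))\<^sup>2 + 2 * (cmod (g x))\<^sup>2) summable_on UNIV"
    by (intro summable_on_add summable_on_cmult_right f g)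
  show "(cmod (f x + g x))\<^sup>2 \<le> 2 * (cmod (f x))\<^sup>2 + 2 * (cmod (g x))\<^sup>2" for x
  proof -
    have "(cmod (f x + g x))\<^sup>2 \<le> (cmod (f x) + cmod (g x))\<^sup>2"
      by (intro power_mono norm_triangle_ineq) simp
    also have "\<dots> \<le> 2 * (cmod (f x))\<^sup>2 + 2 * (cmod (g x))\<^sup>2"
      using sum_squares_bound[of "cmod (f x)" "cmod (g x)"] by (simp add: power2_sum)
    finally show ?thesis .
  qed
qed auto

instantiation ell2 :: (type) real_vector
begin

lift_definition zero_ell2 :: "'a ell2" is "\<lambda>_. 0" by simp
lift_definition plus_ell2 :: "'a ell2 \<Rightarrow> 'a ell2 \<Rightarrow> 'a ell2" is "\<lambda>f g x. f x + g x"
  by (rule ell2_summable_add)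
lift_definition uminus_ell2 :: "'a ell2 \<Rightarrow> 'a ell2" is "\<lambda>f x. - f x" by simp
lift_definition minus_ell2 :: "'a ell2 \<Rightarrow> 'a ell2 \<Rightarrow> 'a ell2" is "\<lambda>f g x. f x - g x"
  using ell2_summable_add[where g = "\<lambda>x. - g x" for g :: "'a \<Rightarrow> complex"] by simp
lift_definition scaleR_ell2 :: "real \<Rightarrow> 'a ell2 \<Rightarrow> 'a ell2" is "\<lambda>r f x. of_real r * f x"
  by (rule ell2_summable_scale)

instance
  by standard (transfer; simp add: fun_eq_iff algebra_simps)+

end

lift_definition scaleC_ell2 :: "complex \<Rightarrow> 'a ell2 \<Rightarrow> 'a ell2" (infixr "*\<^sub>C" 75)
  is "\<lambda>c f x. c * f x"
  by (rule ell2_summable_scale)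

text \<open>Linear in the first argument, conjugate-linear in the second.\<close>

lift_definition cinner :: "'a ell2 \<Rightarrow> 'a ell2 \<Rightarrow> complex"
  is "\<lambda>f g. \<Sum>\<^sub>\<infinity>x. f x * cnj (g x)" .

lift_definition delta :: "'a \<Rightarrow> 'a ell2" is "\<lambda>x y. if y = x then 1 else 0"
proof -
  fix x :: 'a
  have "(\<lambda>y. (cmod (if y = x then 1 else 0))\<^sup>2) summable_on {x}" by simp
  then show "(\<lambda>y. (cmod (if y = x then 1 else 0))\<^sup>2) summable_on UNIV"
    by (rule summable_on_cong_neutral[THEN iffD1, rotated -1]) auto
qed

lemma cinner_commute: "cinner g f = cnj (cinner f g)"
  by transfer (simp add: mult.commute flip: infsum_cnj)

lemma cinner_add_left: "cinner (f + g) h = cinner f h + cinner g h"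
  by transfer (simp add: distrib_right infsum_add ell2_summable_mult)

lemma cinner_scaleC_left: "cinner (c *\<^sub>C f) g = c * cinner f g"
  by transfer (simp add: mult.assoc infsum_cmult_right')

lemma cinner_scaleR_left: "cinner (r *\<^sub>R f) g = of_real r * cinner f g"
  by transfer (simp add: mult.assoc infsum_cmult_right')

lemma Re_cinner_self: "Re (cinner f f) = (\<Sum>\<^sub>\<infinity>x. (cmod (ell2_apply f x))\<^sup>2)"
proof -
  have "(\<lambda>x. ell2_apply f x * cnj (ell2_apply f x)) summable_on UNIV"
    using ell2_apply[of f] by (intro ell2_summable_mult) auto
  then have "Re (cinner f f) = (\<Sum>\<^sub>\<infinity>x. Re (ell2_apply f x * cnj (ell2_apply f x)))"
    by (simp only: cinner.rep_eq infsum_Re)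
  also have "\<dots> = (\<Sum>\<^sub>\<infinity>x. (cmod (ell2_apply f x))\<^sup>2)"
    unfolding cmod_power2 by (simp add: power2_eq_square)
  finally show ?thesis .
qed

instantiation ell2 :: (type) real_inner
begin

definition inner_ell2 :: "'a ell2 \<Rightarrow> 'a ell2 \<Rightarrow> real"
  where "inner_ell2 f g = Re (cinner f g)"
definition norm_ell2 :: "'a ell2 \<Rightarrow> real"
  where "norm_ell2 f = sqrt (\<Sum>\<^sub>\<infinity>x. (cmod (ell2_apply f x))\<^sup>2)"
definition dist_ell2 :: "'a ell2 \<Rightarrow> 'a ell2 \<Rightarrow> real"
  where "dist_ell2 f g = norm (f - g)"
definition sgn_ell2 :: "'a ell2 \<Rightarrow> 'a ell2"
  where "sgn_ell2 f = f /\<^sub>R norm f"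
definition uniformity_ell2 :: "('a ell2 \<times> 'a ell2) filter"
  where "uniformity_ell2 = (INF e\<in>{0<..}. principal {(x, y). dist x y < e})"
definition open_ell2 :: "'a ell2 set \<Rightarrow> bool"
  where "open_ell2 U \<longleftrightarrow> (\<forall>x\<in>U. \<forall>\<^sub>F (x', y) in uniformity. x' = x \<longrightarrow> y \<in> U)"

instance
proof
  fix f g h :: "'a ell2" and r :: real
  show "inner f g = inner g f"
    using cinner_commute[of f g] by (simp add: inner_ell2_def)
  show "inner (f + g) h = inner f h + inner g h"
    by (simp add: inner_ell2_def cinner_add_left)
  show "inner (r *\<^sub>R f) g = r * inner f g"
    by (simp add: inner_ell2_def cinner_scaleR_left)
  show "0 \<le> inner f f"
    by (simp add: inner_ell2_def Re_cinner_self infsum_nonneg)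
  show "norm f = sqrt (inner f f)"
    by (simp add: inner_ell2_def Re_cinner_self norm_ell2_def)
  show "inner f f = 0 \<longleftrightarrow> f = 0"
  proof
    assume "inner f f = 0"
    then have *: "(\<Sum>\<^sub>\<infinity>x. (cmod (ell2_apply f x))\<^sup>2) = 0"
      by (simp add: inner_ell2_def Re_cinner_self)
    have "(\<lambda>x. (cmod (ell2_apply f x))\<^sup>2) summable_on UNIV"
      using ell2_apply[of f] by simp
    then have "(cmod (ell2_apply f x))\<^sup>2 = 0" for x
      by (intro nonneg_infsum_le_0D[where A = UNIV]) (use * in auto)
    then show "f = 0" by transfer auto
  next
    assume "f = 0"
    then show "inner f f = 0" by (simp add: inner_ell2_def Re_cinner_self zero_ell2.rep_eq)
  qed
qed (rule dist_ell2_def sgn_ell2_def uniformity_ell2_def open_ell2_def)+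

end

lemma scaleC_add_right: "c *\<^sub>C (f + g) = c *\<^sub>C f + c *\<^sub>C g"
  by transfer (simp add: fun_eq_iff distrib_left)

lemma scaleC_scaleR: "c *\<^sub>C (r *\<^sub>R f) = r *\<^sub>R (c *\<^sub>C f)"
  by transfer (simp add: fun_eq_iff)

lemma norm_scaleC: "norm (c *\<^sub>C f) = cmod c * norm f"
  unfolding norm_ell2_def
  by (simp add: scaleC_ell2.rep_eq norm_mult power_mult_distrib infsum_cmult_right'
      real_sqrt_mult)

lemma bounded_linear_scaleC: "bounded_linear (\<lambda>f. c *\<^sub>C f)"
  by (rule bounded_linear_intro[where K = "cmod c"])
     (simp_all add: scaleC_add_right scaleC_scaleR norm_scaleC)


section \<open>Bounded operators and the uniform Roe algebra\<close>

text \<open>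
  The library type of bounded operators consists of real-linear maps; the complex-linear ones
  are singled out by \<open>bounded_ops\<close>. The norm on the type is the operator norm.
\<close>

type_synonym 'a ell2_op = "'a ell2 \<Rightarrow>\<^sub>L 'a ell2"

definition bounded_ops :: "'a ell2_op set"
  where "bounded_ops = {a. \<forall>c f. blinfun_apply a (c *\<^sub>C f) = c *\<^sub>C blinfun_apply a f}"

definition scaleC_op :: "complex \<Rightarrow> 'a ell2_op \<Rightarrow> 'a ell2_op"
  where "scaleC_op c a = Blinfun (\<lambda>f. c *\<^sub>C blinfun_apply a f)"

lemma scaleC_op_apply [simp]: "blinfun_apply (scaleC_op c a) f = c *\<^sub>C blinfun_apply a f"
  unfolding scaleC_op_def
  by (subst bounded_linear_Blinfun_apply)
     (auto intro: bounded_linear_compose[OF bounded_linear_scaleC] blinfun.bounded_linear_right)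

definition prop_le :: "'a::metric_space ell2_op \<Rightarrow> real \<Rightarrow> bool"
  where "prop_le a r \<longleftrightarrow>
    (\<forall>x y. dist x y > r \<longrightarrow> cinner (blinfun_apply a (delta x)) (delta y) = 0)"

definition finite_propagation_ops :: "'a::metric_space ell2_op set"
  where "finite_propagation_ops = {a \<in> bounded_ops. \<exists>r>0. prop_le a r}"

definition uniform_roe :: "'a::metric_space ell2_op set"
  where "uniform_roe = closure finite_propagation_ops"

definition approximable :: "real \<Rightarrow> nat \<Rightarrow> 'a::metric_space ell2_op \<Rightarrow> bool"
  where "approximable \<epsilon> k a \<longleftrightarrow> (\<exists>b\<in>bounded_ops. prop_le b (real k) \<and> norm (a - b) \<le> \<epsilon>)"

definition sot_tendsto :: "(nat \<Rightarrow> 'a ell2_op) \<Rightarrow> 'a ell2_op \<Rightarrow> bool"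
  where "sot_tendsto A a \<longleftrightarrow>
    (\<forall>f. (\<lambda>n. blinfun_apply (A n) f) \<longlonglongrightarrow> blinfun_apply a f)"


section \<open>Maps between uniform Roe algebras\<close>

text \<open>
  A map between uniform Roe algebras is a function on all operators of which only the values
  on \<open>uniform_roe\<close> matter.
\<close>

definition roe_linear_map :: "('a::metric_space ell2_op \<Rightarrow> 'b::metric_space ell2_op) \<Rightarrow> bool"
  where "roe_linear_map \<Phi> \<longleftrightarrow>
    \<Phi> \<in> uniform_roe \<rightarrow> uniform_roe \<and>
    (\<forall>a\<in>uniform_roe. \<forall>b\<in>uniform_roe. \<Phi> (a + b) = \<Phi> a + \<Phi> b) \<and>
    (\<forall>c. \<forall>a\<in>uniform_roe. \<Phi> (scaleC_op c a) = scaleC_op c (\<Phi> a))"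

definition strongly_continuous :: "('a::metric_space ell2_op \<Rightarrow> 'b::metric_space ell2_op) \<Rightarrow> bool"
  where "strongly_continuous \<Phi> \<longleftrightarrow>
    (\<forall>A a. (\<forall>n. A n \<in> uniform_roe) \<longrightarrow> a \<in> uniform_roe \<longrightarrow> sot_tendsto A a
      \<longrightarrow> sot_tendsto (\<lambda>n. \<Phi> (A n)) (\<Phi> a))"

definition coarse_like :: "('a::metric_space ell2_op \<Rightarrow> 'b::metric_space ell2_op) \<Rightarrow> bool"
  where "coarse_like \<Phi> \<longleftrightarrow>
    (\<forall>m::nat. \<forall>\<epsilon>>0. \<exists>k. \<forall>a\<in>uniform_roe. norm a \<le> 1 \<longrightarrow> prop_le a (real m)
      \<longrightarrow> approximable \<epsilon> k (\<Phi> a))"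


section \<open>Coarse geometry\<close>

definition uniformly_locally_finite :: "'a::metric_space itself \<Rightarrow> bool"
  where "uniformly_locally_finite _ \<longleftrightarrow>
    (\<forall>r>0. \<exists>N::nat. \<forall>x::'a. finite (cball x r) \<and> card (cball x r) \<le> N)"

text \<open>
  The intersection is required to be nonempty because division by zero yields zero in HOL,
  whereas the ratio in the definition is meant to be infinite in that case.
\<close>

definition property_A :: "'a::metric_space itself \<Rightarrow> bool"
  where "property_A _ \<longleftrightarrow>
    (\<forall>r>0. \<forall>\<epsilon>>0. \<exists>R>0. \<exists>A :: 'a \<Rightarrow> ('a \<times> nat) set.
      (\<forall>x. finite (A x) \<and> (x, 1) \<in> A x) \<and>
      (\<forall>x y. dist x y \<le> r \<longrightarrow> A x \<inter> A y \<noteq> {} \<and>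
        real (card (sym_diff (A x) (A y))) / real (card (A x \<inter> A y)) < \<epsilon>) \<and>
      (\<forall>x y m z n. (y, m) \<in> A x \<longrightarrow> (z, n) \<in> A x \<longrightarrow> dist y z \<le> R))"

end

theory Submission
  imports Defs "HOL-Complex_Analysis.Great_Picard"
begin

text \<open>
  The proof is a Baire category argument on a space of matrices. Fix \<open>m\<close> and \<open>\<epsilon>\<close>, and consider the
  matrices on \<open>X\<close> that vanish at distance more than \<open>m\<close> from the diagonal and have entries of modulus
  at most 1. Since the balls of radius \<open>m\<close> have bounded cardinality, each such matrix defines a
  bounded operator, with a common norm bound (Schur test, \<open>schur_bound\<close>), and every contraction of
  propagation at most \<open>m\<close> arises in this way (\<open>eq_matrix_op\<close>). Unlike the set of contractions,
  the set of these matrices is a product over \<open>x \<in> X\<close> of sets of columns, so that columns of two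
  matrices can be mixed freely.

  Let \<open>F k\<close> be the set of those matrices whose operator is mapped by \<open>\<Phi>\<close> to within \<open>\<epsilon>\<close> of an operator
  on \<open>Y\<close> given by a matrix of bandwidth at most \<open>k\<close> and entries of modulus at most \<open>k\<close>. The sets
  \<open>F k\<close> cover the product, because \<open>\<Phi>\<close> takes values in a norm closure of operators of finite
  propagation. Each \<open>F k\<close> is closed under limits in which every column is eventually constant:
  such limits are strong limits of operators (\<open>sot_tendsto_matrix_op\<close>), which \<open>\<Phi>\<close> preserves, and on
  the side of \<open>Y\<close> a diagonal argument produces a limit of the approximating matrices
  (\<open>band_approximation_closed\<close>). Hence some \<open>F k\<close> contains a cylinder, that is, all matrices that
  agree with a fixed one on a fixed finite set of columns (\<open>uniform_approximation_on_cylinder\<close>).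

  An arbitrary matrix differs from one in this cylinder only in finitely many entries. These
  differences range over a finite-dimensional space with bounded coefficients, on which \<open>\<Phi>\<close> is
  uniformly approximable by linearity (\<open>approximable_finitely_supported\<close>). The two approximations
  add up to one that is uniform over all contractions of propagation at most \<open>m\<close>.
\<close>

section \<open>Coordinates and norms of square-summable families\<close>

lemma ell2_eqI: "(\<And>y. ell2_apply f y = ell2_apply g y) \<Longrightarrow> f = g"
  by (simp add: ell2_apply_inject[symmetric] fun_eq_iff)

lemma ell2_apply_sum: "ell2_apply (\<Sum>x\<in>S. g x) y = (\<Sum>x\<in>S. ell2_apply (g x) y)"
  by (induction S rule: infinite_finite_induct)
     (auto simp: zero_ell2.rep_eq plus_ell2.rep_eq)

lemma ell2_apply_delta: "ell2_apply (delta x) y = (if y = x then 1 else 0)"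
  by (simp add: delta.rep_eq)

lemma cinner_delta_right: "cinner f (delta y) = ell2_apply f y"
proof -
  have "cinner f (delta y) = (\<Sum>\<^sub>\<infinity>x\<in>UNIV. ell2_apply f x * cnj (if x = y then 1 else 0))"
    by (simp add: cinner.rep_eq delta.rep_eq)
  also have "\<dots> = (\<Sum>\<^sub>\<infinity>x\<in>{y}. ell2_apply f x)"
    by (rule infsum_cong_neutral) auto
  finally show ?thesis by simp
qed

lemma prop_le_iff: "prop_le a r \<longleftrightarrow> (\<forall>x y. dist x y > r \<longrightarrow> ell2_apply (a (delta x)) y = 0)"
  by (simp add: prop_le_def cinner_delta_right)

lemma ell2_summable: "(\<lambda>x. (cmod (ell2_apply f x))\<^sup>2) summable_on UNIV"
  using ell2_apply[of f] by simp

lemma norm_ell2_square: "(norm f)\<^sup>2 = (\<Sum>\<^sub>\<infinity>x. (cmod (ell2_apply f x))\<^sup>2)"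
  by (simp add: norm_ell2_def infsum_nonneg)

lemma finite_sum_le_norm_square:
  "finite T \<Longrightarrow> (\<Sum>x\<in>T. (cmod (ell2_apply f x))\<^sup>2) \<le> (norm f)\<^sup>2"
  unfolding norm_ell2_square by (rule finite_sum_le_infsum) (auto simp: ell2_summable)

lemma norm_square_leI:
  assumes "\<And>T. finite T \<Longrightarrow> (\<Sum>x\<in>T. (cmod (ell2_apply f x))\<^sup>2) \<le> B"
  shows "(norm f)\<^sup>2 \<le> B"
  unfolding norm_ell2_square by (rule infsum_le_finite_sums[OF ell2_summable]) (use assms in auto)

lemma cmod_ell2_apply_le: "cmod (ell2_apply f x) \<le> norm f"
  using finite_sum_le_norm_square[of "{x}" f] by (intro power2_le_imp_le[OF _ norm_ge_zero]) simp

lemma norm_delta: "norm (delta x) = 1"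
proof -
  have "(\<Sum>\<^sub>\<infinity>y\<in>UNIV. (cmod (ell2_apply (delta x) y))\<^sup>2) = (\<Sum>\<^sub>\<infinity>y\<in>{x}. 1)"
    by (rule infsum_cong_neutral) (auto simp: ell2_apply_delta)
  then show ?thesis by (simp add: norm_ell2_def)
qed

lemma bounded_linear_ell2_apply: "bounded_linear (\<lambda>f. ell2_apply f y)"
  by (rule bounded_linear_intro[where K = 1])
     (auto simp: plus_ell2.rep_eq scaleR_ell2.rep_eq scaleR_conv_of_real cmod_ell2_apply_le)

lemma norm_minus_truncation_square:
  assumes "finite S"
  shows "(norm (f - (\<Sum>x\<in>S. ell2_apply f x *\<^sub>C delta x)))\<^sup>2
    \<le> (norm f)\<^sup>2 - (\<Sum>x\<in>S. (cmod (ell2_apply f x))\<^sup>2)"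
proof (rule norm_square_leI)
  fix T :: "'a set" assume T: "finite T"
  have coord: "ell2_apply (f - (\<Sum>x\<in>S. ell2_apply f x *\<^sub>C delta x)) y
      = (if y \<in> S then 0 else ell2_apply f y)" for y
  proof -
    have "(\<Sum>x\<in>S. ell2_apply f x * (if y = x then 1 else 0)) = (if y \<in> S then ell2_apply f y else 0)"
      using assms by (simp add: if_distrib cong: if_cong)
    then show ?thesis
      by (simp add: minus_ell2.rep_eq ell2_apply_sum scaleC_ell2.rep_eq ell2_apply_delta)
  qed
  have "(\<Sum>x\<in>T. (cmod (ell2_apply (f - (\<Sum>x\<in>S. ell2_apply f x *\<^sub>C delta x)) x))\<^sup>2)
      = (\<Sum>x\<in>T - S. (cmod (ell2_apply f x))\<^sup>2)"
    unfolding coord using T by (intro sum.mono_neutral_cong_right) auto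
  also have "\<dots> = (\<Sum>x\<in>(T - S) \<union> S. (cmod (ell2_apply f x))\<^sup>2) - (\<Sum>x\<in>S. (cmod (ell2_apply f x))\<^sup>2)"
    using T assms by (subst sum.union_disjoint) auto
  also have "\<dots> \<le> (norm f)\<^sup>2 - (\<Sum>x\<in>S. (cmod (ell2_apply f x))\<^sup>2)"
    using T assms by (intro diff_right_mono finite_sum_le_norm_square) auto
  finally show "(\<Sum>x\<in>T. (cmod (ell2_apply (f - (\<Sum>x\<in>S. ell2_apply f x *\<^sub>C delta x)) x))\<^sup>2)
    \<le> (norm f)\<^sup>2 - (\<Sum>x\<in>S. (cmod (ell2_apply f x))\<^sup>2)" .
qed

text \<open>
  The squared distance from a finite truncation is a tail of the convergent series for the squared
  norm. This makes a bounded complex-linear operator determined by its matrix.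
\<close>

lemma has_sum_delta: "((\<lambda>x. ell2_apply f x *\<^sub>C delta x) has_sum f) UNIV"
proof -
  let ?s = "\<lambda>S. \<Sum>x\<in>S. (cmod (ell2_apply f x))\<^sup>2"
  have "(?s \<longlongrightarrow> (norm f)\<^sup>2) (finite_subsets_at_top UNIV)"
    using has_sum_infsum[OF ell2_summable[of f]] by (simp add: has_sum_def norm_ell2_square)
  then have gap: "((\<lambda>S. (norm f)\<^sup>2 - ?s S) \<longlongrightarrow> (norm f)\<^sup>2 - (norm f)\<^sup>2) (finite_subsets_at_top UNIV)"
    by (intro tendsto_diff tendsto_const)
  have "((\<lambda>S. (norm ((\<Sum>x\<in>S. ell2_apply f x *\<^sub>C delta x) - f))\<^sup>2) \<longlongrightarrow> 0)
      (finite_subsets_at_top UNIV)"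
  proof (rule tendsto_sandwich)
    show "\<forall>\<^sub>F S in finite_subsets_at_top UNIV.
        (norm ((\<Sum>x\<in>S. ell2_apply f x *\<^sub>C delta x) - f))\<^sup>2 \<le> (norm f)\<^sup>2 - ?s S"
      by (rule eventually_finite_subsets_at_top_weakI)
         (subst norm_minus_commute, rule norm_minus_truncation_square)
    show "\<forall>\<^sub>F S in finite_subsets_at_top UNIV.
        0 \<le> (norm ((\<Sum>x\<in>S. ell2_apply f x *\<^sub>C delta x) - f))\<^sup>2"
      by simp
    show "((\<lambda>S. (norm f)\<^sup>2 - ?s S) \<longlongrightarrow> 0) (finite_subsets_at_top UNIV)"
      using gap by simp
  qed (rule tendsto_const)
  from tendsto_real_sqrt[OF this]
  have "((\<lambda>S. norm ((\<Sum>x\<in>S. ell2_apply f x *\<^sub>C delta x) - f)) \<longlongrightarrow> 0) (finite_subsets_at_top UNIV)"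
    by simp
  from LIM_zero_cancel[OF tendsto_norm_zero_cancel[OF this]] show ?thesis
    unfolding has_sum_def .
qed

text \<open>
  This is Fatou's lemma for counting measure. It turns convergence of matrix entries, the only
  convergence available on the side of \<open>Y\<close>, into bounds for operator norms.
\<close>

lemma norm_ell2_le_of_coordinatewise_limit:
  assumes lim: "\<And>y. (\<lambda>n. ell2_apply (f n) y) \<longlonglongrightarrow> ell2_apply g y"
    and le: "\<And>n. norm (f n) \<le> B"
  shows "norm g \<le> B"
proof -
  have B: "0 \<le> B" using norm_ge_zero[of "f 0"] le[of 0] by linarith
  have "(norm g)\<^sup>2 \<le> B\<^sup>2"
  proof (rule norm_square_leI)
    fix T :: "'a set" assume T: "finite T"
    have "(\<lambda>n. \<Sum>x\<in>T. (cmod (ell2_apply (f n) x))\<^sup>2) \<longlonglongrightarrow> (\<Sum>x\<in>T. (cmod (ell2_apply g x))\<^sup>2)"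
      by (intro tendsto_intros lim)
    moreover have "(\<Sum>x\<in>T. (cmod (ell2_apply (f n) x))\<^sup>2) \<le> B\<^sup>2" for n
      using finite_sum_le_norm_square[OF T, of "f n"] power_mono[OF le[of n] norm_ge_zero, of 2]
      by linarith
    ultimately show "(\<Sum>x\<in>T. (cmod (ell2_apply g x))\<^sup>2) \<le> B\<^sup>2"
      by (intro LIMSEQ_le_const2) auto
  qed
  then show ?thesis using B by (rule power2_le_imp_le)
qed


section \<open>Band matrices\<close>

definition band_matrices :: "real \<Rightarrow> real \<Rightarrow> ('a::metric_space \<Rightarrow> 'a \<Rightarrow> complex) set"
  where "band_matrices r C = {c. \<forall>x y. cmod (c x y) \<le> C \<and> (dist x y > r \<longrightarrow> c x y = 0)}"

text \<open>
  The first index is the column: \<open>c x y\<close> is the coefficient of \<open>delta y\<close> in the image of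
  \<open>delta x\<close>. The row sums are written as infinite sums so that no bandwidth has to be recorded as a
  parameter; for a band matrix they are finite.
\<close>

definition matrix_op :: "('a \<Rightarrow> 'a \<Rightarrow> complex) \<Rightarrow> 'a ell2_op"
  where "matrix_op c = Blinfun (\<lambda>f. Abs_ell2 (\<lambda>y. \<Sum>\<^sub>\<infinity>x. c x y * ell2_apply f x))"

text \<open>
  Uniform local finiteness speaks of positive radii only; enlarging the radius to at least 1 covers
  propagation 0 as well.
\<close>

lemma uniformly_locally_finiteE:
  assumes "uniformly_locally_finite TYPE('a::metric_space)"
  obtains N :: nat where "\<And>x::'a. finite (cball x r)" "\<And>x::'a. card (cball x r) \<le> N"
proof -
  obtain N where N: "\<And>x::'a. finite (cball x (max r 1)) \<and> card (cball x (max r 1)) \<le> N"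
    using assms unfolding uniformly_locally_finite_def
    by (metis less_max_iff_disj zero_less_one)
  have sub: "cball x r \<subseteq> cball x (max r 1)" for x :: 'a by auto
  show thesis
  proof
    show "finite (cball x r)" for x :: 'a using N sub finite_subset by blast
    show "card (cball x r) \<le> N" for x :: 'a using N[of x] card_mono[OF _ sub[of x]] by linarith
  qed
qed

lemma band_row_sum:
  assumes "finite (cball (y::'a::metric_space) r)" and c: "c \<in> band_matrices r C"
  shows "(\<Sum>\<^sub>\<infinity>x. c x y * v x) = (\<Sum>x\<in>cball y r. c x y * v x)"
proof -
  have "(\<Sum>\<^sub>\<infinity>x. c x y * v x) = (\<Sum>\<^sub>\<infinity>x\<in>cball y r. c x y * v x)"
    using c by (intro infsum_cong_neutral) (auto simp: band_matrices_def dist_commute)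
  then show ?thesis using assms(1) by simp
qed

text \<open>
  By Cauchy-Schwarz, each coordinate of the image costs a factor \<open>N * C\<^sup>2\<close> against the part of \<open>v\<close>
  in a ball. Each point lies in at most \<open>N\<close> of these balls, which gives the second factor \<open>N\<close>.
\<close>

lemma schur_bound:
  fixes v :: "'a::metric_space \<Rightarrow> complex"
  assumes fin: "\<And>x::'a. finite (cball x r)" and card: "\<And>x::'a. card (cball x r) \<le> N"
    and c: "c \<in> band_matrices r C" and T: "finite T"
    and B: "\<And>S. finite S \<Longrightarrow> (\<Sum>x\<in>S. (cmod (v x))\<^sup>2) \<le> B"
  shows "(\<Sum>y\<in>T. (cmod (\<Sum>x\<in>cball y r. c x y * v x))\<^sup>2) \<le> (real N * C)\<^sup>2 * B"
proof -
  define U where "U = (\<Union>y\<in>T. cball y r)"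
  have U: "finite U" using T fin by (auto simp: U_def)
  have row: "(cmod (\<Sum>x\<in>cball y r. c x y * v x))\<^sup>2 \<le> real N * C\<^sup>2 * (\<Sum>x\<in>cball y r. (cmod (v x))\<^sup>2)" for y
  proof -
    have "(cmod (\<Sum>x\<in>cball y r. c x y * v x))\<^sup>2 \<le> (\<Sum>x\<in>cball y r. C * cmod (v x))\<^sup>2"
      using c by (intro power_mono sum_norm_le)
        (auto simp: norm_mult band_matrices_def intro!: mult_right_mono)
    also have "\<dots> \<le> (\<Sum>x\<in>cball y r. (C * cmod (v x))\<^sup>2) * card (cball y r)"
      by (rule sum_squared_le_sum_of_squares)
    also have "\<dots> \<le> (\<Sum>x\<in>cball y r. (C * cmod (v x))\<^sup>2) * N"
      using card[of y] by (intro mult_left_mono) (auto intro: sum_nonneg)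
    finally show ?thesis
      by (simp add: power_mult_distrib flip: sum_distrib_left) (simp add: algebra_simps)
  qed
  have "(\<Sum>y\<in>T. \<Sum>x\<in>cball y r. (cmod (v x))\<^sup>2) = (\<Sum>y\<in>T. \<Sum>x\<in>{x \<in> U. dist x y \<le> r}. (cmod (v x))\<^sup>2)"
  proof (intro sum.cong refl)
    show "cball y r = {x \<in> U. dist x y \<le> r}" if "y \<in> T" for y
      using that by (auto simp: U_def) (metis dist_commute)+
  qed
  also have "\<dots> = (\<Sum>x\<in>U. \<Sum>y\<in>{y \<in> T. dist x y \<le> r}. (cmod (v x))\<^sup>2)"
    by (rule sum.swap_restrict[OF T U])
  also have "\<dots> \<le> (\<Sum>x\<in>U. real N * (cmod (v x))\<^sup>2)"
  proof (rule sum_mono)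
    fix x
    have "card {y \<in> T. dist x y \<le> r} \<le> card (cball x r)" by (intro card_mono fin) auto
    also have "\<dots> \<le> N" by (rule card)
    finally show "(\<Sum>y\<in>{y \<in> T. dist x y \<le> r}. (cmod (v x))\<^sup>2) \<le> real N * (cmod (v x))\<^sup>2"
      by (simp add: mult_right_mono)
  qed
  also have "\<dots> \<le> real N * B"
    using B[OF U] by (simp add: mult_left_mono flip: sum_distrib_left)
  finally have "real N * C\<^sup>2 * (\<Sum>y\<in>T. \<Sum>x\<in>cball y r. (cmod (v x))\<^sup>2) \<le> real N * C\<^sup>2 * (real N * B)"
    by (intro mult_left_mono) auto
  moreover have "(\<Sum>y\<in>T. (cmod (\<Sum>x\<in>cball y r. c x y * v x))\<^sup>2)
      \<le> real N * C\<^sup>2 * (\<Sum>y\<in>T. \<Sum>x\<in>cball y r. (cmod (v x))\<^sup>2)"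
    unfolding sum_distrib_left by (intro sum_mono) (use row in \<open>simp add: sum_distrib_left\<close>)
  ultimately show ?thesis by (simp add: power2_eq_square algebra_simps)
qed

context
  fixes r :: real and N :: nat and C :: real and c :: "'a::metric_space \<Rightarrow> 'a \<Rightarrow> complex"
  assumes fin: "\<And>x::'a. finite (cball x r)" and card: "\<And>x::'a. card (cball x r) \<le> N"
    and c: "c \<in> band_matrices r C"
begin

lemma matrix_op_aux:
  defines "A \<equiv> \<lambda>f. Abs_ell2 (\<lambda>y. \<Sum>\<^sub>\<infinity>x. c x y * ell2_apply f x)"
  shows "ell2_apply (A f) y = (\<Sum>x\<in>cball y r. c x y * ell2_apply f x)"
    and "bounded_linear A"
    and "norm (A f) \<le> real N * C * norm f"
proof -
  have bound: "(\<Sum>y\<in>T. (cmod (\<Sum>x\<in>cball y r. c x y * ell2_apply f x))\<^sup>2) \<le> (real N * C)\<^sup>2 * (norm f)\<^sup>2"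
    if "finite T" for T f
    by (rule schur_bound[OF fin card c that finite_sum_le_norm_square])
  have summable: "(\<lambda>y. (cmod (\<Sum>x\<in>cball y r. c x y * ell2_apply f x))\<^sup>2) summable_on UNIV" for f
    by (rule nonneg_bdd_above_summable_on) (auto intro!: bdd_aboveI2 bound)
  have row: "(\<Sum>\<^sub>\<infinity>x. c x y * ell2_apply f x) = (\<Sum>x\<in>cball y r. c x y * ell2_apply f x)" for y f
    by (rule band_row_sum[OF fin c])
  have coord: "ell2_apply (A f) y = (\<Sum>x\<in>cball y r. c x y * ell2_apply f x)" for f y
    unfolding A_def row by (subst Abs_ell2_inverse) (use summable in auto)
  then show "ell2_apply (A f) y = (\<Sum>x\<in>cball y r. c x y * ell2_apply f x)" .
  have "0 \<le> C"
    using c norm_ge_zero[of "c undefined undefined"] unfolding band_matrices_def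
    by (metis (mono_tags, lifting) mem_Collect_eq order_trans)
  have norm: "norm (A f) \<le> real N * C * norm f" for f
  proof -
    have "(norm (A f))\<^sup>2 \<le> (real N * C)\<^sup>2 * (norm f)\<^sup>2"
      by (rule norm_square_leI) (use bound coord in simp)
    then have "(norm (A f))\<^sup>2 \<le> (real N * C * norm f)\<^sup>2"
      by (simp add: power_mult_distrib)
    then show ?thesis by (rule power2_le_imp_le) (simp add: \<open>0 \<le> C\<close>)
  qed
  then show "norm (A f) \<le> real N * C * norm f" .
  show "bounded_linear A"
  proof (rule bounded_linear_intro[where K = "real N * C"])
    show "A (f + g) = A f + A g" for f g
      by (rule ell2_eqI) (simp add: coord plus_ell2.rep_eq distrib_left sum.distrib)
    show "A (s *\<^sub>R f) = s *\<^sub>R A f" for s f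
      by (rule ell2_eqI) (simp add: coord scaleR_ell2.rep_eq sum_distrib_left mult.left_commute)
    show "norm (A f) \<le> norm f * (real N * C)" for f
      using norm[of f] by (simp add: mult.commute)
  qed
qed

lemma ell2_apply_matrix_op:
  "ell2_apply (matrix_op c f) y = (\<Sum>x\<in>cball y r. c x y * ell2_apply f x)"
  unfolding matrix_op_def by (simp add: bounded_linear_Blinfun_apply matrix_op_aux)

lemma norm_matrix_op_apply_le: "norm (matrix_op c f) \<le> real N * C * norm f"
  unfolding matrix_op_def by (simp add: bounded_linear_Blinfun_apply matrix_op_aux)

lemma matrix_op_in_bounded_ops: "matrix_op c \<in> bounded_ops"
  unfolding bounded_ops_def mem_Collect_eq
  by (intro allI ell2_eqI)
     (simp add: ell2_apply_matrix_op scaleC_ell2.rep_eq sum_distrib_left mult.left_commute)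

lemma matrix_op_delta: "ell2_apply (matrix_op c (delta x)) y = c x y"
proof -
  have "ell2_apply (matrix_op c (delta x)) y = (if x \<in> cball y r then c x y else 0)"
    using fin by (simp add: ell2_apply_matrix_op ell2_apply_delta if_distrib cong: if_cong)
  then show ?thesis using c by (auto simp: band_matrices_def dist_commute)
qed

lemma prop_le_matrix_op: "prop_le (matrix_op c) r"
  using c by (auto simp: prop_le_iff matrix_op_delta band_matrices_def)

lemma matrix_op_in_uniform_roe: "matrix_op c \<in> uniform_roe"
proof -
  have "prop_le (matrix_op c) (max r 1)"
    using prop_le_matrix_op by (auto simp: prop_le_def)
  then have "matrix_op c \<in> finite_propagation_ops"
    using matrix_op_in_bounded_ops unfolding finite_propagation_ops_def
    by (auto intro!: exI[of _ "max r 1"])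
  then show ?thesis unfolding uniform_roe_def using closure_subset by blast
qed

end

lemma ell2_apply_op:
  assumes "b \<in> bounded_ops"
  shows "((\<lambda>x. ell2_apply (blinfun_apply b (delta x)) y * ell2_apply f x) has_sum ell2_apply (blinfun_apply b f) y) UNIV"
proof -
  have "bounded_linear (\<lambda>f. ell2_apply (blinfun_apply b f) y)"
    by (intro bounded_linear_compose[OF bounded_linear_ell2_apply] blinfun.bounded_linear_right)
  from has_sum_bounded_linear[OF this has_sum_delta[of f]] show ?thesis
    using assms by (simp add: bounded_ops_def scaleC_ell2.rep_eq mult.commute)
qed

text \<open>
  Entries of a matrix are bounded by the norm of its operator, so that every operator of
  bounded propagation is given by a band matrix. With \<open>C = 1\<close> this embeds the contractions into a
  product set, at the price of also admitting operators of larger norm.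
\<close>

lemma eq_matrix_op:
  fixes b :: "'a::metric_space ell2_op"
  assumes fin: "\<And>x::'a. finite (cball x r)" and card: "\<And>x::'a. card (cball x r) \<le> N"
    and b: "b \<in> bounded_ops" "prop_le b r" and C: "norm b \<le> C"
  defines "c \<equiv> \<lambda>x y. ell2_apply (blinfun_apply b (delta x)) y"
  shows "c \<in> band_matrices r C" and "b = matrix_op c"
proof -
  have "cmod (c x y) \<le> C" for x y
    using cmod_ell2_apply_le[of "blinfun_apply b (delta x)" y] norm_blinfun[of b "delta x"] C
    unfolding c_def norm_delta by linarith
  then show c: "c \<in> band_matrices r C"
    using b by (auto simp: band_matrices_def prop_le_iff c_def)
  have "ell2_apply (blinfun_apply b f) y = ell2_apply (matrix_op c f) y" for f y
    using infsumI[OF ell2_apply_op[OF b(1), of y f]] band_row_sum[OF fin c, of y "ell2_apply f"]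
    unfolding ell2_apply_matrix_op[OF fin card c] by (simp add: c_def)
  then show "b = matrix_op c"
    by (intro blinfun_eqI ell2_eqI)
qed

lemma closed_bounded_ops: "closed (bounded_ops :: 'a ell2_op set)"
proof -
  have "closed (\<Inter>c f. {a :: 'a ell2_op. blinfun_apply a (c *\<^sub>C f) - c *\<^sub>C blinfun_apply a f = 0})"
    by (intro closed_INT ballI closed_Collect_eq continuous_intros
        bounded_linear.continuous_on[OF bounded_linear_scaleC])
  moreover have "(bounded_ops :: 'a ell2_op set) = (\<Inter>c f. {a. blinfun_apply a (c *\<^sub>C f) - c *\<^sub>C blinfun_apply a f = 0})"
    by (auto simp: bounded_ops_def)
  ultimately show ?thesis by (simp only:)
qed

lemma uniform_roe_subset_bounded_ops: "uniform_roe \<subseteq> bounded_ops"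
  unfolding uniform_roe_def
  by (rule closure_minimal) (auto simp: finite_propagation_ops_def closed_bounded_ops)

section \<open>A Baire category argument on product sets\<close>

text \<open>
  This is Baire's theorem for a product of discrete spaces, with the sets that fix all coordinates in
  some \<open>E n\<close> as a base of the topology. If no \<open>F k\<close> contained a cylinder, each cylinder could be shrunk to one that misses
  \<open>F k\<close>, for \<open>k = 0, 1, 2, \<dots>\<close> in turn, and the point that all these cylinders have in common
  would lie in no \<open>F k\<close>.
\<close>

lemma cylinder_baire:
  fixes K :: "'i \<Rightarrow> 'v set" and E :: "nat \<Rightarrow> 'i set" and F :: "nat \<Rightarrow> ('i \<Rightarrow> 'v) set"
  defines "D \<equiv> {c. \<forall>i. c i \<in> K i}"
  assumes ne: "D \<noteq> {}" and mono: "mono E" and exhaust: "\<And>i. \<exists>n. i \<in> E n"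
    and cover: "D \<subseteq> (\<Union>k. F k)"
    and closed: "\<And>k c. c \<in> D \<Longrightarrow> (\<And>n. \<exists>d\<in>D \<inter> F k. \<forall>i\<in>E n. d i = c i) \<Longrightarrow> c \<in> F k"
  shows "\<exists>k n. \<exists>c\<in>D. \<forall>d\<in>D. (\<forall>i\<in>E n. d i = c i) \<longrightarrow> d \<in> F k"
proof (rule ccontr)
  assume "\<not> ?thesis"
  then have escape: "\<exists>d\<in>D. (\<forall>i\<in>E n. d i = c i) \<and> d \<notin> F k" if "c \<in> D" for k n c
    using that by blast
  have step: "\<exists>d n'. d \<in> D \<and> n \<le> n' \<and> k \<le> n' \<and> (\<forall>i\<in>E n. d i = c i) \<and>
      (\<forall>e\<in>D. (\<forall>i\<in>E n'. e i = d i) \<longrightarrow> e \<notin> F k)" if c: "c \<in> D" for k n c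
  proof -
    obtain d where d: "d \<in> D" "\<forall>i\<in>E n. d i = c i" "d \<notin> F k" using escape[OF c] by blast
    from closed[OF d(1), of k] d(3) obtain n0 where n0: "\<And>e. e \<in> D \<inter> F k \<Longrightarrow> \<not> (\<forall>i\<in>E n0. e i = d i)"
      by blast
    let ?n' = "max n0 (max n k)"
    have "E n0 \<subseteq> E ?n'" using mono by (simp add: monoD)
    then have "\<forall>e\<in>D. (\<forall>i\<in>E ?n'. e i = d i) \<longrightarrow> e \<notin> F k" using n0 by blast
    with d show ?thesis by (intro exI[of _ d] exI[of _ ?n']) auto
  qed
  \<comment> \<open>A pair of a point and a number \<open>n\<close> stands for the cylinder around the point with coordinates
    in \<open>E n\<close> fixed; \<open>k \<le> n\<close> ensures that in the limit all coordinates are fixed.\<close>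
  define P where "P k p \<longleftrightarrow> fst p \<in> D \<and> k \<le> snd p \<and>
      (\<forall>e\<in>D. (\<forall>i\<in>E (snd p). e i = fst p i) \<longrightarrow> e \<notin> F k)" for k and p :: "('i \<Rightarrow> 'v) \<times> nat"
  define Q where "Q p q \<longleftrightarrow> snd p \<le> snd q \<and> (\<forall>i\<in>E (snd p). fst q i = fst p i)"
    for p q :: "('i \<Rightarrow> 'v) \<times> nat"
  have "\<exists>s. \<forall>k. P k (s k) \<and> Q (s k) (s (Suc k))"
  proof (rule dependent_nat_choice)
    obtain c where "c \<in> D" using ne by blast
    from step[OF this, of 0 0] show "\<exists>p. P 0 p" unfolding P_def by auto
    show "\<exists>q. P (Suc k) q \<and> Q p q" if "P k p" for k p
      using step[of "fst p" "snd p" "Suc k"] that unfolding P_def Q_def by auto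
  qed
  then obtain s where s: "\<And>k. P k (s k)" "\<And>k. Q (s k) (s (Suc k))" by blast
  let ?d = "\<lambda>k. fst (s k)" and ?n = "\<lambda>k. snd (s k)"
  have agree: "?n k \<le> ?n (k + j) \<and> (\<forall>i\<in>E (?n k). ?d (k + j) i = ?d k i)" for k j
  proof (induction j)
    case (Suc j)
    have "E (?n k) \<subseteq> E (?n (k + j))" using Suc mono by (simp add: monoD)
    then show ?case using Suc s(2)[of "k + j"] unfolding Q_def by fastforce
  qed simp
  have "\<forall>i. \<exists>k. i \<in> E (?n k)"
  proof
    fix i
    obtain n where "i \<in> E n" using exhaust by blast
    moreover have "E n \<subseteq> E (?n n)" using s(1)[of n] mono by (simp add: P_def monoD)
    ultimately show "\<exists>k. i \<in> E (?n k)" by blast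
  qed
  then obtain \<kappa> where \<kappa>: "\<And>i. i \<in> E (?n (\<kappa> i))" by metis
  define c where "c i = ?d (\<kappa> i) i" for i
  have c: "c i = ?d k i" if "i \<in> E (?n k)" for i k
    using agree[of k "\<kappa> i - k"] agree[of "\<kappa> i" "k - \<kappa> i"] \<kappa>[of i] that
    unfolding c_def by (cases "k \<le> \<kappa> i") auto
  have "c \<in> D"
    using s(1) by (auto simp: c_def D_def P_def)
  moreover have "c \<notin> F k" for k
    using s(1)[of k] c \<open>c \<in> D\<close> unfolding P_def by blast
  ultimately show False using cover by blast
qed


section \<open>Approximation by operators of bounded propagation\<close>

lemma bounded_ops_eqI:
  assumes "a \<in> bounded_ops" "b \<in> bounded_ops"
    and "\<And>x y. ell2_apply (blinfun_apply a (delta x)) y = ell2_apply (blinfun_apply b (delta x)) y"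
  shows "a = b"
proof -
  have "ell2_apply (blinfun_apply a f) y = ell2_apply (blinfun_apply b f) y" for f y
    using has_sum_unique[OF ell2_apply_op[OF assms(1), of y f]] ell2_apply_op[OF assms(2), of y f] assms(3)
    by simp
  then show ?thesis by (intro blinfun_eqI ell2_eqI)
qed

lemma bounded_ops_zero: "0 \<in> bounded_ops"
  by (auto simp: bounded_ops_def intro!: ell2_eqI simp: scaleC_ell2.rep_eq zero_ell2.rep_eq)

lemma bounded_ops_add: "a \<in> bounded_ops \<Longrightarrow> b \<in> bounded_ops \<Longrightarrow> a + b \<in> bounded_ops"
  by (simp add: bounded_ops_def blinfun.add_left scaleC_add_right)

lemma bounded_ops_scaleC: "a \<in> bounded_ops \<Longrightarrow> scaleC_op s a \<in> bounded_ops"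
  unfolding bounded_ops_def mem_Collect_eq
  by (intro allI ell2_eqI) (simp add: scaleC_ell2.rep_eq mult.left_commute)

lemma norm_scaleC_op_le: "norm (scaleC_op s a) \<le> cmod s * norm a"
  by (rule norm_blinfun_bound)
     (auto simp: norm_scaleC mult.assoc intro!: mult_left_mono norm_blinfun)

lemma approximable_mono:
  assumes "approximable \<epsilon> k a" "\<epsilon> \<le> \<epsilon>'" "k \<le> k'"
  shows "approximable \<epsilon>' k' a"
  using assms unfolding approximable_def prop_le_def
  by (meson le_less_trans of_nat_mono order_trans)

lemma approximable_zero: "0 \<le> \<epsilon> \<Longrightarrow> approximable \<epsilon> k 0"
  unfolding approximable_def
  by (rule bexI[OF _ bounded_ops_zero]) (simp add: prop_le_iff zero_ell2.rep_eq)

lemma approximable_add: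
  assumes "approximable \<epsilon> k a" "approximable \<delta> l b"
  shows "approximable (\<epsilon> + \<delta>) (max k l) (a + b)"
proof -
  obtain a' b' where a': "a' \<in> bounded_ops" "prop_le a' k" "norm (a - a') \<le> \<epsilon>"
    and b': "b' \<in> bounded_ops" "prop_le b' l" "norm (b - b') \<le> \<delta>"
    using assms unfolding approximable_def by blast
  have "prop_le (a' + b') (real (max k l))"
    using a'(2) b'(2) by (simp add: prop_le_iff blinfun.add_left plus_ell2.rep_eq)
  moreover have "norm (a + b - (a' + b')) \<le> \<epsilon> + \<delta>"
    using norm_triangle_ineq[of "a - a'" "b - b'"] a'(3) b'(3) by (simp add: algebra_simps)
  ultimately show ?thesis
    unfolding approximable_def using bounded_ops_add[OF a'(1) b'(1)] by blast
qed

lemma approximable_scaleC: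
  assumes "approximable \<epsilon> k a"
  shows "approximable (cmod s * \<epsilon>) k (scaleC_op s a)"
proof -
  obtain b where b: "b \<in> bounded_ops" "prop_le b k" "norm (a - b) \<le> \<epsilon>"
    using assms unfolding approximable_def by blast
  have "scaleC_op s a - scaleC_op s b = scaleC_op s (a - b)"
    by (intro blinfun_eqI ell2_eqI)
       (simp add: blinfun.diff_left scaleC_ell2.rep_eq minus_ell2.rep_eq right_diff_distrib)
  then have "norm (scaleC_op s a - scaleC_op s b) \<le> cmod s * \<epsilon>"
    using norm_scaleC_op_le[of s "a - b"] mult_left_mono[OF b(3), of "cmod s"] by simp
  moreover have "prop_le (scaleC_op s b) k"
    using b(2) by (simp add: prop_le_iff scaleC_ell2.rep_eq)
  ultimately show ?thesis
    unfolding approximable_def using bounded_ops_scaleC[OF b(1)] by blast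
qed

lemma uniform_roe_approximable:
  assumes "a \<in> uniform_roe" "\<epsilon> > 0"
  shows "\<exists>k. approximable \<epsilon> k a"
proof -
  obtain b r where b: "b \<in> bounded_ops" "prop_le b r" "dist b a < \<epsilon>"
    using assms unfolding uniform_roe_def closure_approachable finite_propagation_ops_def by blast
  have "prop_le b (real (nat \<lceil>r\<rceil>))"
    using b(2) unfolding prop_le_def by (meson le_less_trans real_nat_ceiling_ge)
  moreover have "norm (a - b) \<le> \<epsilon>"
    using b(3) by (simp add: dist_norm norm_minus_commute)
  ultimately show ?thesis using b(1) unfolding approximable_def by blast
qed

text \<open>
  The operators agree on vectors supported in \<open>E n\<close>, and by the Schur test they are uniformly
  bounded on the remainder of a given vector, which tends to 0.
\<close>

lemma sot_tendsto_matrix_op: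
  fixes c :: "'a::metric_space \<Rightarrow> 'a \<Rightarrow> complex"
  assumes fin: "\<And>x::'a. finite (cball x r)" and card: "\<And>x::'a. card (cball x r) \<le> N"
    and c: "c \<in> band_matrices r C" and d: "\<And>n. d n \<in> band_matrices r C"
    and E: "filterlim E (finite_subsets_at_top UNIV) sequentially"
    and agree: "\<And>n x. x \<in> E n \<Longrightarrow> d n x = c x"
  shows "sot_tendsto (\<lambda>n. matrix_op (d n)) (matrix_op c)"
  unfolding sot_tendsto_def
proof
  fix f :: "'a ell2"
  define p where "p n = (\<Sum>x\<in>E n. ell2_apply f x *\<^sub>C delta x)" for n
  have p: "p \<longlonglongrightarrow> f"
    unfolding p_def using filterlim_compose[OF has_sum_delta[of f, unfolded has_sum_def] E] .
  have same: "matrix_op (d n) (p n) = matrix_op c (p n)" for n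
  proof -
    have "matrix_op (d n) (delta x) = matrix_op c (delta x)" if "x \<in> E n" for x
      by (rule ell2_eqI)
         (simp add: matrix_op_delta[OF fin card d] matrix_op_delta[OF fin card c] agree[OF that])
    moreover have "matrix_op (d n) \<in> bounded_ops" "matrix_op c \<in> bounded_ops"
      by (rule matrix_op_in_bounded_ops[OF fin card d], rule matrix_op_in_bounded_ops[OF fin card c])
    ultimately show ?thesis
      unfolding p_def blinfun.sum_right by (intro sum.cong) (auto simp: bounded_ops_def)
  qed
  have bound: "norm (matrix_op (d n) f - matrix_op c f) \<le> 2 * (real N * C) * norm (f - p n)" for n
  proof -
    have "matrix_op (d n) f - matrix_op c f = matrix_op (d n) (f - p n) - matrix_op c (f - p n)"
      by (simp add: blinfun.diff_right same)
    then have "norm (matrix_op (d n) f - matrix_op c f)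
        = norm (matrix_op (d n) (f - p n) - matrix_op c (f - p n))" by (rule arg_cong)
    then show ?thesis
      using norm_triangle_ineq4[of "matrix_op (d n) (f - p n)" "matrix_op c (f - p n)"]
        norm_matrix_op_apply_le[OF fin card d[of n], of "f - p n"]
        norm_matrix_op_apply_le[OF fin card c, of "f - p n"]
      by linarith
  qed
  have "(\<lambda>n. norm (f - p n)) \<longlonglongrightarrow> 0"
    using tendsto_norm[OF tendsto_diff[OF tendsto_const[of f] p]] by simp
  then have "(\<lambda>n. 2 * (real N * C) * norm (f - p n)) \<longlonglongrightarrow> 0"
    by (rule tendsto_mult_right_zero)
  then have "(\<lambda>n. matrix_op (d n) f - matrix_op c f) \<longlonglongrightarrow> 0"
    by (rule Lim_null_comparison[OF always_eventually[OF allI[OF bound]]])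
  then show "(\<lambda>n. matrix_op (d n) f) \<longlonglongrightarrow> matrix_op c f"
    by (rule LIM_zero_cancel)
qed

lemma balls_exhaust:
  fixes x0 :: "'a::metric_space"
  assumes "uniformly_locally_finite TYPE('a)"
  shows "filterlim (\<lambda>n. cball x0 (real n)) (finite_subsets_at_top UNIV) sequentially"
  unfolding filterlim_finite_subsets_at_top
proof (intro allI impI)
  fix S :: "'a set" assume S: "finite S \<and> S \<subseteq> UNIV"
  have fin: "finite (cball x0 (real n))" for n
    by (rule uniformly_locally_finiteE[OF assms]) auto
  have "\<forall>\<^sub>F n in sequentially. dist x0 x \<le> real n" for x
    using filterlim_real_sequentially unfolding filterlim_at_top by blast
  then have "\<forall>\<^sub>F n in sequentially. \<forall>x\<in>S. dist x0 x \<le> real n"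
    using S by (intro eventually_ball_finite) auto
  then show "\<forall>\<^sub>F n in sequentially. finite (cball x0 (real n)) \<and> S \<subseteq> cball x0 (real n)
      \<and> cball x0 (real n) \<subseteq> UNIV"
    by eventually_elim (use fin in auto)
qed

lemma uniformly_locally_finite_countable:
  assumes "uniformly_locally_finite TYPE('a::metric_space)"
  shows "countable (UNIV :: 'a set)"
proof -
  fix x0 :: 'a
  have "UNIV = (\<Union>n. cball x0 (real n))"
    by (auto intro: real_arch_simple)
  moreover have "countable (\<Union>n. cball x0 (real n))"
    by (intro countable_UN countableI_type) (rule uniformly_locally_finiteE[OF assms], blast intro: countable_finite)
  ultimately show ?thesis by simp
qed

text \<open>
  A subsequence of the approximating matrices converges in every entry, because there are countably
  many entries and each stays bounded. The limit is again a band matrix, and since its rows are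
  finite, its operator is a coordinatewise limit; the error bound therefore persists.
\<close>

lemma band_approximation_closed:
  fixes b :: "'a::metric_space ell2_op"
  assumes ulf: "uniformly_locally_finite TYPE('a)"
    and lim: "sot_tendsto a b"
    and e: "\<And>n. e n \<in> band_matrices r C" and le: "\<And>n. norm (a n - matrix_op (e n)) \<le> \<epsilon>"
  shows "\<exists>e\<in>band_matrices r C. norm (b - matrix_op e) \<le> \<epsilon>"
proof -
  obtain N where fin: "\<And>x::'a. finite (cball x r)" and card: "\<And>x::'a. card (cball x r) \<le> N"
    using uniformly_locally_finiteE[OF ulf, of r] by blast
  have "countable (UNIV :: ('a \<times> 'a) set)"
    using uniformly_locally_finite_countable[OF ulf] by (metis UNIV_Times_UNIV countable_SIGMA)
  moreover have "norm (e n (fst p) (snd p)) \<le> C" for n p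
    using e by (simp add: band_matrices_def)
  ultimately obtain \<sigma> where \<sigma>: "strict_mono (\<sigma> :: nat \<Rightarrow> nat)"
    and conv: "\<And>p. \<exists>l. (\<lambda>n. e (\<sigma> n) (fst p) (snd p)) \<longlonglongrightarrow> l"
    by (rule function_convergent_subsequence[where f = "\<lambda>n p. e n (fst p) (snd p)" and S = UNIV and M = C]) auto
  have "\<forall>x. \<exists>v. \<forall>y. (\<lambda>n. e (\<sigma> n) x y) \<longlonglongrightarrow> v y"
    using conv[of "(_, _)"] by (intro allI choice) simp
  then obtain l where l: "\<And>x y. (\<lambda>n. e (\<sigma> n) x y) \<longlonglongrightarrow> l x y" by metis
  have l_band: "l \<in> band_matrices r C"
    unfolding band_matrices_def mem_Collect_eq
  proof (intro allI conjI impI)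
    fix x y
    show "cmod (l x y) \<le> C"
      using e by (intro LIMSEQ_le_const2[OF tendsto_norm[OF l]]) (auto simp: band_matrices_def)
    assume "r < dist x y"
    then have "e (\<sigma> n) x y = 0" for n
      using e by (auto simp: band_matrices_def)
    then show "l x y = 0"
      using l[of x y] by (simp add: LIMSEQ_const_iff)
  qed
  have "norm (b - matrix_op l) \<le> \<epsilon>"
  proof (rule norm_blinfun_bound)
    show "0 \<le> \<epsilon>" using le[of 0] norm_ge_zero order_trans by blast
    fix f
    show "norm (blinfun_apply (b - matrix_op l) f) \<le> \<epsilon> * norm f"
    proof (rule norm_ell2_le_of_coordinatewise_limit)
      fix n
      show "norm (blinfun_apply (a (\<sigma> n) - matrix_op (e (\<sigma> n))) f) \<le> \<epsilon> * norm f"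
        using norm_blinfun[of "a (\<sigma> n) - matrix_op (e (\<sigma> n))" f]
          mult_right_mono[OF le[of "\<sigma> n"] norm_ge_zero[of f]] by linarith
    next
      fix y
      have "(\<lambda>n. blinfun_apply (a (\<sigma> n)) f) \<longlonglongrightarrow> blinfun_apply b f"
        using LIMSEQ_subseq_LIMSEQ[OF _ \<sigma>] lim unfolding sot_tendsto_def comp_def by blast
      then have "(\<lambda>n. ell2_apply (blinfun_apply (a (\<sigma> n)) f) y) \<longlonglongrightarrow> ell2_apply (blinfun_apply b f) y"
        by (rule bounded_linear.tendsto[OF bounded_linear_ell2_apply])
      moreover have "(\<lambda>n. ell2_apply (matrix_op (e (\<sigma> n)) f) y) \<longlonglongrightarrow> ell2_apply (matrix_op l f) y"
        unfolding ell2_apply_matrix_op[OF fin card e] ell2_apply_matrix_op[OF fin card l_band]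
        by (intro tendsto_intros l)
      ultimately show "(\<lambda>n. ell2_apply (blinfun_apply (a (\<sigma> n) - matrix_op (e (\<sigma> n))) f) y)
          \<longlonglongrightarrow> ell2_apply (blinfun_apply (b - matrix_op l) f) y"
        by (simp add: blinfun.diff_left minus_ell2.rep_eq tendsto_diff)
    qed
  qed
  with l_band show ?thesis by blast
qed


section \<open>Linear maps on the uniform Roe algebra\<close>

text \<open>
  The matrices supported in \<open>I\<close> span a finite-dimensional space with the matrix units as basis. It
  suffices to approximate the image of each matrix unit, since the coefficients are bounded by \<open>C\<close>.
\<close>

lemma approximable_finitely_supported:
  fixes \<Phi> :: "'x::metric_space ell2_op \<Rightarrow> 'y::metric_space ell2_op"
  assumes ulf: "uniformly_locally_finite TYPE('x)" and lin: "roe_linear_map \<Phi>"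
    and I: "finite I" and \<epsilon>: "\<epsilon> > 0"
  shows "\<exists>k. \<forall>c\<in>band_matrices r C. (\<forall>x y. (x, y) \<notin> I \<longrightarrow> c x y = 0) \<longrightarrow>
    approximable \<epsilon> k (\<Phi> (matrix_op c))"
  using I \<epsilon>
proof (induction I arbitrary: \<epsilon> rule: finite_induct)
  case empty
  have "approximable \<epsilon> 0 (\<Phi> (matrix_op c))" if c: "\<forall>x y. (x, y) \<notin> {} \<longrightarrow> c x y = 0" for c
  proof -
    have zero: "matrix_op c = scaleC_op 0 (matrix_op c)"
      using c by (intro blinfun_eqI ell2_eqI)
        (simp add: matrix_op_def scaleC_ell2.rep_eq zero_ell2_def[symmetric] zero_ell2.rep_eq
          bounded_linear_Blinfun_apply)
    obtain N where fin: "\<And>x::'x. finite (cball x 0)" and card: "\<And>x::'x. card (cball x 0) \<le> N"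
      using uniformly_locally_finiteE[OF ulf, of 0] by blast
    have "c \<in> band_matrices 0 0" using c by (simp add: band_matrices_def)
    then have "matrix_op c \<in> uniform_roe" by (rule matrix_op_in_uniform_roe[OF fin card])
    then have "\<Phi> (matrix_op c) = scaleC_op 0 (\<Phi> (matrix_op c))"
      using lin zero unfolding roe_linear_map_def by metis
    also have "\<dots> = 0"
      by (intro blinfun_eqI ell2_eqI) (simp add: scaleC_ell2.rep_eq zero_ell2.rep_eq)
    finally show ?thesis using empty by (simp add: approximable_zero)
  qed
  then show ?case by blast
next
  case (insert p I)
  obtain x y where p: "p = (x, y)" by fastforce
  \<comment> \<open>The new matrix unit is treated with bandwidth \<open>dist x y\<close>, which may exceed \<open>r\<close>; in that case
    its coefficient is zero.\<close>
  define u :: "'x \<Rightarrow> 'x \<Rightarrow> complex" where "u = (\<lambda>x' y'. if x' = x \<and> y' = y then 1 else 0)"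
  obtain N where fin: "\<And>x::'x. finite (cball x r)" and card: "\<And>x::'x. card (cball x r) \<le> N"
    using uniformly_locally_finiteE[OF ulf, of r] by blast
  obtain N' where fin': "\<And>z::'x. finite (cball z (dist x y))"
      and card': "\<And>z::'x. card (cball z (dist x y)) \<le> N'"
    using uniformly_locally_finiteE[OF ulf, of "dist x y"] by blast
  have u: "u \<in> band_matrices (dist x y) 1" by (auto simp: u_def band_matrices_def)
  have u_roe: "matrix_op u \<in> uniform_roe" by (rule matrix_op_in_uniform_roe[OF fin' card' u])
  have "\<Phi> (matrix_op u) \<in> uniform_roe" using lin u_roe unfolding roe_linear_map_def by blast
  \<comment> \<open>The absolute value keeps the denominator positive for every real \<open>C\<close>.\<close>
  then obtain k1 where k1: "approximable (\<epsilon> / (2 * (\<bar>C\<bar> + 1))) k1 (\<Phi> (matrix_op u))"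
    using uniform_roe_approximable[of "\<Phi> (matrix_op u)" "\<epsilon> / (2 * (\<bar>C\<bar> + 1))"] insert.prems
    by (auto simp: field_simps)
  obtain k2 where k2: "\<And>c. c \<in> band_matrices r C \<Longrightarrow> (\<forall>x y. (x, y) \<notin> I \<longrightarrow> c x y = 0) \<Longrightarrow>
      approximable (\<epsilon> / 2) k2 (\<Phi> (matrix_op c))"
    using insert.IH[of "\<epsilon> / 2"] insert.prems by auto
  have "approximable \<epsilon> (max k2 k1) (\<Phi> (matrix_op c))"
    if c: "c \<in> band_matrices r C" and supp: "\<forall>x y. (x, y) \<notin> insert p I \<longrightarrow> c x y = 0" for c
  proof -
    have C: "cmod (c x y) \<le> C" using c by (simp add: band_matrices_def)
    then have "0 \<le> C" using norm_ge_zero order_trans by blast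
    define c' where "c' = (\<lambda>x' y'. if x' = x \<and> y' = y then 0 else c x' y')"
    have c': "c' \<in> band_matrices r C"
      using c \<open>0 \<le> C\<close> by (auto simp: c'_def band_matrices_def)
    have c'_roe: "matrix_op c' \<in> uniform_roe" by (rule matrix_op_in_uniform_roe[OF fin card c'])
    have "matrix_op c = matrix_op c' + scaleC_op (c x y) (matrix_op u)"
    proof (rule bounded_ops_eqI)
      show "matrix_op c \<in> bounded_ops" by (rule matrix_op_in_bounded_ops[OF fin card c])
      show "matrix_op c' + scaleC_op (c x y) (matrix_op u) \<in> bounded_ops"
        by (intro bounded_ops_add bounded_ops_scaleC matrix_op_in_bounded_ops[OF fin card c']
            matrix_op_in_bounded_ops[OF fin' card' u])
      show "ell2_apply (matrix_op c (delta x')) y'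
          = ell2_apply ((matrix_op c' + scaleC_op (c x y) (matrix_op u)) (delta x')) y'" for x' y'
        by (simp add: blinfun.add_left plus_ell2.rep_eq scaleC_ell2.rep_eq
            matrix_op_delta[OF fin card c] matrix_op_delta[OF fin card c']
            matrix_op_delta[OF fin' card' u]) (simp add: c'_def u_def)
    qed
    moreover have "scaleC_op (c x y) (matrix_op u) \<in> uniform_roe"
    proof -
      have "prop_le (scaleC_op (c x y) (matrix_op u)) (max (dist x y) 1)"
        using prop_le_matrix_op[OF fin' card' u] by (simp add: prop_le_iff scaleC_ell2.rep_eq)
      then have "scaleC_op (c x y) (matrix_op u) \<in> finite_propagation_ops"
        using bounded_ops_scaleC[OF matrix_op_in_bounded_ops[OF fin' card' u]]
        unfolding finite_propagation_ops_def by (auto intro!: exI[of _ "max (dist x y) 1"])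
      then show ?thesis unfolding uniform_roe_def using closure_subset by blast
    qed
    ultimately have "\<Phi> (matrix_op c) = \<Phi> (matrix_op c') + scaleC_op (c x y) (\<Phi> (matrix_op u))"
      using lin c'_roe u_roe unfolding roe_linear_map_def by simp
    moreover have "approximable (\<epsilon> / 2) k2 (\<Phi> (matrix_op c'))"
      using supp by (intro k2 c') (auto simp: c'_def p)
    moreover have "cmod (c x y) * (\<epsilon> / (2 * (\<bar>C\<bar> + 1))) \<le> \<epsilon> / 2"
    proof -
      have "cmod (c x y) * \<epsilon> \<le> (\<bar>C\<bar> + 1) * \<epsilon>"
        using C insert.prems by (intro mult_right_mono) auto
      then show ?thesis by (simp add: field_simps)
    qed
    then have "approximable (\<epsilon> / 2) k1 (scaleC_op (c x y) (\<Phi> (matrix_op u)))"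
      using approximable_mono[OF approximable_scaleC[OF k1]] by blast
    ultimately show ?thesis
      using approximable_add[of "\<epsilon> / 2" k2 _ "\<epsilon> / 2" k1] by simp
  qed
  then show ?case by blast
qed

text \<open>
  The sets \<open>F k\<close> in the proof bound the entries of the approximating matrices along with their
  bandwidth. This builds in the compactness that makes each \<open>F k\<close> closed, without appeal to a norm
  bound for \<open>\<Phi>\<close>.
\<close>

lemma uniform_approximation_on_cylinder:
  fixes \<Phi> :: "'x::metric_space ell2_op \<Rightarrow> 'y::metric_space ell2_op"
  assumes ulf_x: "uniformly_locally_finite TYPE('x)" and ulf_y: "uniformly_locally_finite TYPE('y)"
    and lin: "roe_linear_map \<Phi>" and cont: "strongly_continuous \<Phi>" and \<epsilon>: "\<epsilon> > 0"
  shows "\<exists>k S. finite S \<and> (\<exists>c\<in>band_matrices r 1. \<forall>d\<in>band_matrices r 1.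
    (\<forall>x\<in>S. d x = c x) \<longrightarrow> approximable \<epsilon> k (\<Phi> (matrix_op d)))"
proof -
  obtain N where fin: "\<And>x::'x. finite (cball x r)" and card: "\<And>x::'x. card (cball x r) \<le> N"
    using uniformly_locally_finiteE[OF ulf_x, of r] by blast
  define E where "E n = cball (undefined :: 'x) (real n)" for n
  have E_lim: "filterlim E (finite_subsets_at_top UNIV) sequentially"
    unfolding E_def by (rule balls_exhaust[OF ulf_x])
  have E_fin: "finite (E n)" for n
    unfolding E_def by (rule uniformly_locally_finiteE[OF ulf_x]) auto
  define K where "K x = {v. \<forall>y. cmod (v y) \<le> 1 \<and> (dist x y > r \<longrightarrow> v y = 0)}" for x :: 'x
  have D: "{c. \<forall>x. c x \<in> K x} = band_matrices r 1"
    by (auto simp: K_def band_matrices_def)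
  define F where "F k = {c. \<exists>e\<in>band_matrices (real k) (real k).
      norm (\<Phi> (matrix_op c) - matrix_op e) \<le> \<epsilon>}" for k
  have roe: "matrix_op c \<in> uniform_roe" if "c \<in> band_matrices r 1" for c :: "'x \<Rightarrow> 'x \<Rightarrow> complex"
    by (rule matrix_op_in_uniform_roe[OF fin card that])
  have "\<exists>k n. \<exists>c\<in>{c. \<forall>x. c x \<in> K x}. \<forall>d\<in>{c. \<forall>x. c x \<in> K x}. (\<forall>x\<in>E n. d x = c x) \<longrightarrow> d \<in> F k"
  proof (rule cylinder_baire, unfold D)
    have "(\<lambda>x y. 0) \<in> band_matrices r 1" by (simp add: band_matrices_def)
    then show "band_matrices r 1 \<noteq> {}" by blast
    show "mono E" by (auto simp: E_def mono_def)
    show "\<exists>n. x \<in> E n" for x by (auto simp: E_def intro: real_arch_simple)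
    show "band_matrices r 1 \<subseteq> (\<Union>k. F k)"
    proof
      fix c :: "'x \<Rightarrow> 'x \<Rightarrow> complex" assume "c \<in> band_matrices r 1"
      then have "\<Phi> (matrix_op c) \<in> uniform_roe"
        using lin roe unfolding roe_linear_map_def by blast
      from uniform_roe_approximable[OF this \<epsilon>] obtain l b where
        b: "b \<in> bounded_ops" "prop_le b (real l)" "norm (\<Phi> (matrix_op c) - b) \<le> \<epsilon>"
        unfolding approximable_def by blast
      define k where "k = max l (nat \<lceil>norm b\<rceil>)"
      obtain M where fin': "\<And>y::'y. finite (cball y (real k))"
        and card': "\<And>y::'y. card (cball y (real k)) \<le> M"
        using uniformly_locally_finiteE[OF ulf_y, of "real k"] by blast
      have b_prop: "prop_le b (real k)" using b(2) by (simp add: prop_le_def k_def)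
      have b_norm: "norm b \<le> real k" unfolding k_def by linarith
      have "c \<in> F k"
        unfolding F_def
        using eq_matrix_op[OF fin' card' b(1) b_prop b_norm] b(3) by (metis (mono_tags, lifting) mem_Collect_eq)
      then show "c \<in> (\<Union>k. F k)" by blast
    qed
  next
    fix k :: nat and c :: "'x \<Rightarrow> 'x \<Rightarrow> complex"
    assume c: "c \<in> band_matrices r 1"
      and approx: "\<And>n. \<exists>d\<in>band_matrices r 1 \<inter> F k. \<forall>x\<in>E n. d x = c x"
    obtain d where d: "\<And>n. d n \<in> band_matrices r 1" "\<And>n. d n \<in> F k" "\<And>n x. x \<in> E n \<Longrightarrow> d n x = c x"
      using approx by (metis IntD1 IntD2)
    obtain e where e: "\<And>n. e n \<in> band_matrices (real k) (real k)"
      "\<And>n. norm (\<Phi> (matrix_op (d n)) - matrix_op (e n)) \<le> \<epsilon>"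
      using d(2) unfolding F_def mem_Collect_eq by metis
    have "sot_tendsto (\<lambda>n. matrix_op (d n)) (matrix_op c)"
      by (rule sot_tendsto_matrix_op[OF fin card c d(1) E_lim d(3)])
    then have "sot_tendsto (\<lambda>n. \<Phi> (matrix_op (d n))) (\<Phi> (matrix_op c))"
      using cont[unfolded strongly_continuous_def, rule_format,
          of "\<lambda>n. matrix_op (d n)" "matrix_op c"] roe[OF d(1)] roe[OF c] by simp
    from band_approximation_closed[OF ulf_y this e] show "c \<in> F k"
      by (simp add: F_def)
  qed
  then obtain k n c where c: "c \<in> band_matrices r 1"
    and F: "\<And>d. d \<in> band_matrices r 1 \<Longrightarrow> (\<forall>x\<in>E n. d x = c x) \<Longrightarrow> d \<in> F k"
    unfolding D by blast
  obtain M where fin': "\<And>y::'y. finite (cball y (real k))"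
    and card': "\<And>y::'y. card (cball y (real k)) \<le> M"
    using uniformly_locally_finiteE[OF ulf_y, of "real k"] by blast
  have "approximable \<epsilon> k (\<Phi> (matrix_op d))" if "d \<in> F k" for d
    using that matrix_op_in_bounded_ops[OF fin' card'] prop_le_matrix_op[OF fin' card']
    unfolding F_def approximable_def by blast
  then show ?thesis using E_fin c F by blast
qed

text \<open>
  Overwriting the columns in \<open>S\<close> by those of the centre \<open>c0\<close> moves any matrix into the cylinder.
  The correction \<open>d\<close> is a difference of two matrices with entries of modulus at most 1,
  supported in the finitely many positions of the band that lie in these columns.
\<close>

lemma coarse_like_of_strongly_continuous:
  fixes \<Phi> :: "'x::metric_space ell2_op \<Rightarrow> 'y::metric_space ell2_op"
  assumes ulf_x: "uniformly_locally_finite TYPE('x)" and ulf_y: "uniformly_locally_finite TYPE('y)"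
    and lin: "roe_linear_map \<Phi>" and cont: "strongly_continuous \<Phi>"
  shows "coarse_like \<Phi>"
  unfolding coarse_like_def
proof (intro allI impI)
  fix m :: nat and \<epsilon> :: real assume \<epsilon>: "\<epsilon> > 0"
  obtain N where fin: "\<And>x::'x. finite (cball x (real m))" and card: "\<And>x::'x. card (cball x (real m)) \<le> N"
    using uniformly_locally_finiteE[OF ulf_x, of "real m"] by blast
  obtain k S c0 where S: "finite S" and c0: "c0 \<in> band_matrices (real m) 1"
    and k: "\<forall>d\<in>band_matrices (real m) 1. (\<forall>x\<in>S. d x = c0 x) \<longrightarrow>
        approximable (\<epsilon> / 2) k (\<Phi> (matrix_op d))"
    using uniform_approximation_on_cylinder[OF ulf_x ulf_y lin cont half_gt_zero[OF \<epsilon>], of "real m"]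
    by (elim exE conjE bexE)
  define I where "I = (SIGMA x:S. cball x (real m))"
  have "finite I" unfolding I_def by (intro finite_SigmaI S fin)
  from approximable_finitely_supported[OF ulf_x lin this half_gt_zero[OF \<epsilon>], of "real m" 2]
  obtain l where l: "\<forall>d\<in>band_matrices (real m) 2. (\<forall>x y. (x, y) \<notin> I \<longrightarrow> d x y = 0) \<longrightarrow>
      approximable (\<epsilon> / 2) l (\<Phi> (matrix_op d))"
    by (elim exE)
  have "approximable \<epsilon> (max k l) (\<Phi> a)"
    if a: "a \<in> uniform_roe" "norm a \<le> 1" "prop_le a (real m)" for a
  proof -
    obtain c where c: "c \<in> band_matrices (real m) 1" and a_eq: "a = matrix_op c"
      using eq_matrix_op[OF fin card _ a(3,2)] uniform_roe_subset_bounded_ops a(1) by blast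
    define c' where "c' x = (if x \<in> S then c0 x else c x)" for x
    define d where "d x y = c x y - c' x y" for x y
    have c': "c' \<in> band_matrices (real m) 1"
      using c c0 by (simp add: c'_def band_matrices_def)
    have d: "d \<in> band_matrices (real m) 2"
    proof -
      have "cmod (d x y) \<le> 2" for x y
        using norm_triangle_ineq4[of "c x y" "c' x y"] c c'
        unfolding d_def band_matrices_def mem_Collect_eq by (smt (verit))
      then show ?thesis using c c' by (simp add: d_def band_matrices_def)
    qed
    have "matrix_op c = matrix_op c' + matrix_op d"
    proof (rule bounded_ops_eqI)
      show "matrix_op c \<in> bounded_ops" by (rule matrix_op_in_bounded_ops[OF fin card c])
      show "matrix_op c' + matrix_op d \<in> bounded_ops"
        by (intro bounded_ops_add matrix_op_in_bounded_ops[OF fin card c']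
            matrix_op_in_bounded_ops[OF fin card d])
      show "ell2_apply (matrix_op c (delta x)) y
          = ell2_apply ((matrix_op c' + matrix_op d) (delta x)) y" for x y
        by (simp add: blinfun.add_left plus_ell2.rep_eq matrix_op_delta[OF fin card c]
            matrix_op_delta[OF fin card c'] matrix_op_delta[OF fin card d]) (simp add: d_def)
    qed
    then have "\<Phi> a = \<Phi> (matrix_op c') + \<Phi> (matrix_op d)"
      using lin matrix_op_in_uniform_roe[OF fin card c'] matrix_op_in_uniform_roe[OF fin card d]
      unfolding a_eq roe_linear_map_def by simp
    moreover have "approximable (\<epsilon> / 2) k (\<Phi> (matrix_op c'))"
      using k c' by (simp add: c'_def)
    moreover have "approximable (\<epsilon> / 2) l (\<Phi> (matrix_op d))"
    proof (rule l[rule_format, OF d])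
      show "d x y = 0" if "(x, y) \<notin> I" for x y
        using that c c0 by (cases "x \<in> S") (auto simp: I_def d_def c'_def band_matrices_def not_le)
    qed
    ultimately show ?thesis
      using approximable_add[of "\<epsilon> / 2" k _ "\<epsilon> / 2" l] by simp
  qed
  then show "\<exists>k. \<forall>a\<in>uniform_roe. norm a \<le> 1 \<longrightarrow> prop_le a (real m) \<longrightarrow> approximable \<epsilon> k (\<Phi> a)"
    by blast
qed

theorem theorem3p4:
  fixes \<Phi> :: "'x::metric_space ell2_op \<Rightarrow> 'y::metric_space ell2_op"
  assumes "uniformly_locally_finite TYPE('x)"
    and "uniformly_locally_finite TYPE('y)"
    and "roe_linear_map \<Phi>"
    and "strongly_continuous \<Phi>"
    and "property_A TYPE('y)"
  shows "coarse_like \<Phi>"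
  using assms(1-4) by (rule coarse_like_of_strongly_continuous)

end
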